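(* Let $X$ be a diametrically regular metric space, let $\alpha>0$ and let $\mu$ be a measure over $X$. If $A\subset X$ and $(\mathcal F_b)_{\mu,\zeta_{b,\alpha}}$ covers $A$ finely, then $\mathfrak s^\alpha(\mu,\cdot):A\to[0,+\infty]$ is Borel with respect to the subspace topology of $A$.
   Context: A "measure over $X$" is an outer measure defined on all subsets of $X$. For $x\in X$, $r>0$, $B(x,r)=\{y\in X:d(x,y)<r\}$ and $\mathbb B(x,r)=\{y\in X:d(x,y)\le r\}$ are the open and closed balls. $X$ is diametrically regular if for every $x\in X$ there exist $R_x>0$ and $\delta_x>0$ such that for every $y\in B(x,R_x)$ the function $(0,\delta_x)\ni r\mapsto\operatorname{diam}(B(y,r))$ is continuous. $\mathcal F_b$ is the family of all closed balls $\mathbb B(x,r)$ in $X$ ($x\in X$, $r>0$), $c_\alpha>0$ is a fixed constant, and $\zeta_{b,\alpha}:\mathcal F_b\to[0,+\infty)$ is $\zeta_{b,\alpha}(S)=c_\alpha\operatorname{diam}(S)^\alpha$. $(\mathcal F_b)_{\mu,\zeta_{b,\alpha}}=\mathcal F_b\setminus\{S\in\mathcal F_b:\ \zeta_{b,\alpha}(S)=\mu(S)=0\ \text{or}\ \mu(S)=\zeta_{b,\alpha}(S)=+\infty\}$. A family $\mathcal G\subset\mathcal P(X)$ covers $A$ finely if for every $a\in A$ and $\epsilon>0$ there is $S\in\mathcal G$ with $a\in S$ and $\operatorname{diam}(S)<\epsilon$. The quotient function $Q:(\mathcal F_b)_{\mu,\zeta_{b,\alpha}}\to[0,+\infty]$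 is $Q(S)=+\infty$ if $\zeta_{b,\alpha}(S)=0$ and $Q(S)=\mu(S)/\zeta_{b,\alpha}(S)$ if $\zeta_{b,\alpha}(S)>0$. For $x\in A$ the Federer density is $$\mathfrak s^\alpha(\mu,x)=\inf_{\epsilon>0}\sup\{Q(S): S\in(\mathcal F_b)_{\mu,\zeta_{b,\alpha}},\ x\in S,\ \operatorname{diam}(S)<\epsilon\}.$$ *)

theory Defs
  imports "HOL-Analysis.Analysis"
begin

text \<open>
  The library's \<^const>\<open>diameter\<close> is real-valued and only meaningful on bounded sets. All balls are
  bounded; where an arbitrary family of sets is allowed, boundedness is demanded explicitly.
\<close>

definition diametrically_regular :: "'a::metric_space itself \<Rightarrow> bool" where
  "diametrically_regular _ \<longleftrightarrow>
     (\<forall>x::'a. \<exists>R>0. \<exists>\<delta>>0. \<forall>y\<in>ball x R.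
        continuous_on {0<..<\<delta>} (\<lambda>r. diameter (ball y r)))"

definition closed_balls :: "'a::metric_space set set" where
  "closed_balls = {cball x r | x r. 0 < r}"

definition zeta :: "real \<Rightarrow> real \<Rightarrow> 'a::metric_space set \<Rightarrow> ennreal" where
  "zeta c \<alpha> S = ennreal (c * diameter S powr \<alpha>)"

definition nondegenerate ::
    "'a set set \<Rightarrow> ('a set \<Rightarrow> ennreal) \<Rightarrow> ('a set \<Rightarrow> ennreal) \<Rightarrow> 'a set set" where
  "nondegenerate F \<mu> \<zeta> =
     F - {S \<in> F. (\<zeta> S = 0 \<and> \<mu> S = 0) \<or> (\<mu> S = \<infinity> \<and> \<zeta> S = \<infinity>)}"

definition covers_finely :: "'a::metric_space set set \<Rightarrow> 'a set \<Rightarrow> bool" where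
  "covers_finely G A \<longleftrightarrow>
     (\<forall>a\<in>A. \<forall>\<epsilon>>0. \<exists>S\<in>G. a \<in> S \<and> bounded S \<and> diameter S < \<epsilon>)"

definition quotient_fun ::
    "('a set \<Rightarrow> ennreal) \<Rightarrow> ('a set \<Rightarrow> ennreal) \<Rightarrow> 'a set \<Rightarrow> ennreal" where
  "quotient_fun \<mu> \<zeta> S = (if \<zeta> S = 0 then \<infinity> else \<mu> S / \<zeta> S)"

definition federer_density ::
    "real \<Rightarrow> real \<Rightarrow> ('a::metric_space set \<Rightarrow> ennreal) \<Rightarrow> 'a \<Rightarrow> ennreal" where
  "federer_density c \<alpha> \<mu> x =
     (INF \<epsilon>\<in>{0<..}. SUP S\<in>{S \<in> nondegenerate closed_balls \<mu> (zeta c \<alpha>). x \<in> S \<and> diameter S < \<epsilon>}.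
        quotient_fun \<mu> (zeta c \<alpha>) S)"

definition subspace_borel :: "'a::topological_space set \<Rightarrow> 'a measure" where
  "subspace_borel A = sigma A {U. openin (top_of_set A) U}"

lemma relatively_open_subset: "{U. openin (top_of_set A) U} \<subseteq> Pow A"
  by (auto dest: openin_imp_subset)

lemma space_subspace_borel [simp]: "space (subspace_borel A) = A"
  unfolding subspace_borel_def using relatively_open_subset by (rule space_measure_of)

lemma sets_subspace_borel: "sets (subspace_borel A) = sets (restrict_space borel A)"
proof -
  have "sets (restrict_space borel A) =
      {(\<lambda>x. x) -` B \<inter> A | B. B \<in> sigma_sets UNIV (Collect open)}"
    unfolding sets_restrict_space sets_borel by auto
  also have "\<dots> = sigma_sets A {(\<lambda>x. x) -` B \<inter> A | B. B \<in> Collect open}"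
    by (rule sigma_sets_vimage_commute) simp
  also have "{(\<lambda>x. x) -` B \<inter> A | B. B \<in> Collect open} = {U. openin (top_of_set A) U}"
    by (auto simp: openin_open)
  also have "sigma_sets A {U. openin (top_of_set A) U} = sets (subspace_borel A)"
    unfolding subspace_borel_def using relatively_open_subset by (rule sets_measure_of[symmetric])
  finally show ?thesis ..
qed

text \<open>
  The library states countable subadditivity for disjoint sequences only. On the full power set,
  \<^const>\<open>outer_measure_space\<close> is nevertheless the usual notion of an outer measure.
\<close>

lemma outer_measure_space_UNIV_iff:
  "outer_measure_space (UNIV :: 'a set set) \<mu> \<longleftrightarrow>
     \<mu> {} = 0 \<and> (\<forall>S T. S \<subseteq> T \<longrightarrow> \<mu> S \<le> \<mu> T) \<and>
     (\<forall>S :: nat \<Rightarrow> 'a set. \<mu> (\<Union>i. S i) \<le> (\<Sum>i. \<mu> (S i)))" for \<mu> :: "'a set \<Rightarrow> ennreal"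
proof
  assume L: "outer_measure_space (UNIV :: 'a set set) \<mu>"
  have zero: "\<mu> {} = 0" and mono: "\<And>S T. S \<subseteq> T \<Longrightarrow> \<mu> S \<le> \<mu> T"
    and sub: "\<And>S :: nat \<Rightarrow> 'a set. disjoint_family S \<Longrightarrow> \<mu> (\<Union>i. S i) \<le> (\<Sum>i. \<mu> (S i))"
    using L unfolding outer_measure_space_def positive_def increasing_def
      countably_subadditive_def by auto
  have "\<mu> (\<Union>i. S i) \<le> (\<Sum>i. \<mu> (S i))" for S :: "nat \<Rightarrow> 'a set"
  proof -
    have "\<mu> (\<Union>i. S i) = \<mu> (\<Union>i. disjointed S i)"
      by (simp add: UN_disjointed_eq)
    also have "\<dots> \<le> (\<Sum>i. \<mu> (disjointed S i))"
      by (rule sub) (rule disjoint_family_disjointed)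
    also have "\<dots> \<le> (\<Sum>i. \<mu> (S i))"
      by (intro suminf_le mono disjointed_subset summableI)
    finally show ?thesis .
  qed
  with zero mono show "\<mu> {} = 0 \<and> (\<forall>S T. S \<subseteq> T \<longrightarrow> \<mu> S \<le> \<mu> T) \<and>
     (\<forall>S :: nat \<Rightarrow> 'a set. \<mu> (\<Union>i. S i) \<le> (\<Sum>i. \<mu> (S i)))" by blast
qed (auto simp: outer_measure_space_def positive_def increasing_def countably_subadditive_def)

end

theory Submission
  imports Defs
begin

text \<open>
  Call \<open>f \<epsilon>\<close> the supremum over balls of diameter below \<open>\<epsilon>\<close> in the definition of the density. If a
  closed ball \<open>S\<close> through \<open>x\<close> has \<open>Q S > t\<close>, i.e. \<open>\<mu> S > t * \<zeta> S\<close>, then so does every slightly larger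
  concentric ball, because \<open>\<mu>\<close> is monotone and diametric regularity makes \<open>\<zeta>\<close> continuous from the
  right in the radius; the larger ball contains a neighbourhood of \<open>x\<close>. Hence \<open>f \<epsilon>\<close> is lower
  semicontinuous wherever the regularity constants are at least \<open>\<epsilon>\<close>. Since \<open>X\<close> need not be separable,
  one cannot pass from local to global Borel measurability by a countable subcover; instead \<open>X\<close> is
  exhausted by the open sets on which the constants are locally at least \<open>1 / n\<close>.
\<close>

text \<open>One parameter bounds both the distance of the centre and the radius, so that it can
  later be matched with the diameter bound in \<open>upper_quotient\<close>.\<close>

definition uniformly_regular :: "real \<Rightarrow> 'a::metric_space set" where
  "uniformly_regular e =
     {x. \<forall>y\<in>ball x e. continuous_on {0<..<e} (\<lambda>r. diameter (ball y r))}"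

definition upper_quotient ::
    "real \<Rightarrow> real \<Rightarrow> ('a::metric_space set \<Rightarrow> ennreal) \<Rightarrow> real \<Rightarrow> 'a \<Rightarrow> ennreal" where
  "upper_quotient c \<alpha> \<mu> \<epsilon> x =
     (SUP S\<in>{S \<in> nondegenerate closed_balls \<mu> (zeta c \<alpha>). x \<in> S \<and> diameter S < \<epsilon>}.
        quotient_fun \<mu> (zeta c \<alpha>) S)"

lemma uniformly_regular_antimono: "e \<le> e' \<Longrightarrow> uniformly_regular e' \<subseteq> uniformly_regular e"
  unfolding uniformly_regular_def by (force intro: continuous_on_subset)

lemma diametrically_regular_imp_interior:
  fixes x :: "'a::metric_space"
  assumes "diametrically_regular TYPE('a)"
  obtains e where "e > 0" "x \<in> interior (uniformly_regular e)"
proof -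
  obtain R \<delta> where R: "R > 0" and \<delta>: "\<delta> > 0"
    and cont: "\<And>y. y \<in> ball x R \<Longrightarrow> continuous_on {0<..<\<delta>} (\<lambda>r. diameter (ball y r))"
    using assms unfolding diametrically_regular_def by metis
  \<comment> \<open>Halving \<open>R\<close> leaves room for two steps of length \<open>e\<close>,
    from \<open>x\<close> to \<open>z\<close> and from \<open>z\<close> to \<open>y\<close>, so a
    whole ball about \<open>x\<close> is uniformly regular.\<close>
  define e where "e = min (R / 2) \<delta>"
  have e: "e > 0" "e \<le> \<delta>" "2 * e \<le> R"
    using R \<delta> by (auto simp: e_def)
  have "continuous_on {0<..<e} (\<lambda>r. diameter (ball y r))"
    if "z \<in> ball x e" "y \<in> ball z e" for y z
  proof -
    have "y \<in> ball x R"
      using that e dist_triangle[of x y z] by simp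
    from cont[OF this] show ?thesis
      by (rule continuous_on_subset) (use e in auto)
  qed
  then have "ball x e \<subseteq> uniformly_regular e"
    by (auto simp: uniformly_regular_def)
  then have "x \<in> interior (uniformly_regular e)"
    using e by (meson centre_in_ball interior_maximal open_ball subsetD)
  with e that show thesis by blast
qed

text \<open>The product form absorbs the conventions. If \<open>\<zeta> S = 0\<close>, both sides
  say that \<open>S \<in> F\<close> and \<open>\<mu> S \<noteq> 0\<close>, as \<open>t\<close> is
  finite; if \<open>\<zeta> S\<close> is positive and finite, \<open>S\<close> is never excluded and
  one may multiply by it.\<close>

lemma nondegenerate_quotient_gt_iff:
  fixes t :: ennreal
  assumes "\<zeta> S < top" "t < top"
  shows "S \<in> nondegenerate F \<mu> \<zeta> \<and> t < quotient_fun \<mu> \<zeta> S \<longleftrightarrow> S \<in> F \<and> t * \<zeta> S < \<mu> S"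
proof (cases "\<zeta> S = 0")
  case True
  then show ?thesis
    using assms by (auto simp: nondegenerate_def quotient_fun_def zero_less_iff_neq_zero)
next
  case False
  then have pos: "0 < \<zeta> S"
    by (simp add: zero_less_iff_neq_zero)
  have "\<mu> S / \<zeta> S * \<zeta> S = \<mu> S"
    using False assms(1) by (simp add: ennreal_divide_times mult_divide_eq_ennreal)
  then have "\<mu> S / \<zeta> S \<le> t \<longleftrightarrow> \<mu> S \<le> t * \<zeta> S"
    using divide_le_posI_ennreal[OF pos] mult_right_mono[of "\<mu> S / \<zeta> S" t "\<zeta> S"]
    by (auto simp: mult.commute)
  then have "t < \<mu> S / \<zeta> S \<longleftrightarrow> t * \<zeta> S < \<mu> S"
    by (simp flip: not_le)
  with False assms show ?thesis
    by (auto simp: nondegenerate_def quotient_fun_def)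
qed

lemma upper_quotient_gt_iff:
  assumes "t < top"
  shows "t < upper_quotient c \<alpha> \<mu> \<epsilon> x \<longleftrightarrow>
    (\<exists>y r. r > 0 \<and> x \<in> cball y r \<and> diameter (cball y r) < \<epsilon> \<and>
       t * zeta c \<alpha> (cball y r) < \<mu> (cball y r))"
proof -
  have fin: "zeta c \<alpha> S < top" for S :: "'a set"
    by (simp add: zeta_def)
  have "t < upper_quotient c \<alpha> \<mu> \<epsilon> x \<longleftrightarrow> (\<exists>S. (S \<in> nondegenerate closed_balls \<mu> (zeta c \<alpha>) \<and>
      t < quotient_fun \<mu> (zeta c \<alpha>) S) \<and> x \<in> S \<and> diameter S < \<epsilon>)"
    by (auto simp: upper_quotient_def less_SUP_iff)
  also have "\<dots> \<longleftrightarrow> (\<exists>S\<in>closed_balls. x \<in> S \<and> diameter S < \<epsilon> \<and> t * zeta c \<alpha> S < \<mu> S)"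
    unfolding nondegenerate_quotient_gt_iff[OF fin assms] by blast
  also have "\<dots> \<longleftrightarrow> (\<exists>y r. r > 0 \<and> x \<in> cball y r \<and> diameter (cball y r) < \<epsilon> \<and>
       t * zeta c \<alpha> (cball y r) < \<mu> (cball y r))"
    unfolding closed_balls_def by blast
  finally show ?thesis .
qed

text \<open>
  A ball of small diameter may be given with a large radius, outside the range where regularity
  says anything, e.g. when its centre is isolated.
\<close>
lemma cball_shrink_radius:
  fixes y :: "'a::metric_space"
  assumes "r > 0" "diameter (cball y r) < \<epsilon>"
  obtains r' where "0 < r'" "r' < \<epsilon>" "cball y r' = cball y r"
proof -
  define d where "d = diameter (cball y r)"
  have d: "0 \<le> d" "d < \<epsilon>"
    using assms by (auto simp: d_def diameter_ge_0)
  have le: "dist y z \<le> d" if "z \<in> cball y r" for z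
    unfolding d_def using that assms by (intro diameter_bounded_bound) auto
  \<comment> \<open>The midpoint of \<open>d\<close> and \<open>\<epsilon>\<close> is positive even
    when \<open>d = 0\<close>; being at least \<open>d\<close>, it still captures all of
    \<open>cball y r\<close>.\<close>
  show thesis
    by (rule that[of "min r ((d + \<epsilon>) / 2)"]) (use assms d le in \<open>force simp: min_def\<close>)+
qed

lemma zeta_mono:
  assumes "S \<subseteq> T" "bounded T" "c > 0" "\<alpha> > 0"
  shows "zeta c \<alpha> S \<le> zeta c \<alpha> T"
  unfolding zeta_def using assms bounded_subset[OF assms(2,1)]
  by (intro ennreal_leI mult_left_mono powr_mono2 diameter_subset diameter_ge_0) auto

text \<open>Regularity speaks of open balls, the density of closed ones; nesting bridges the gap.
  The strict bounds pass from \<open>cball y r\<close> down to \<open>ball y r\<close>, persist by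
  continuity for \<open>ball y s\<close> with \<open>s\<close> slightly above \<open>r\<close>, and
  pass down again to the closed ball of radius \<open>(r + s) / 2\<close>.\<close>

lemma cball_enlarge:
  fixes y :: "'a::metric_space"
  assumes cont: "continuous_on {0<..<e} (\<lambda>r. diameter (ball y r))"
    and r: "0 < r" "r < e" and "c > 0" "\<alpha> > 0" "t < top"
    and diam: "diameter (cball y r) < \<epsilon>" and m: "t * zeta c \<alpha> (cball y r) < m"
  obtains s where "r < s" "diameter (cball y s) < \<epsilon>" "t * zeta c \<alpha> (cball y s) < m"
proof -
  have lim: "((\<lambda>s. diameter (ball y s)) \<longlongrightarrow> diameter (ball y r)) (at_right r)"
  proof (rule filterlim_mono[OF _ order_refl at_le])
    show "(\<lambda>s. diameter (ball y s)) \<midarrow>r\<rightarrow> diameter (ball y r)"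
      using cont r by (auto simp: continuous_on_eq_continuous_at continuous_at)
  qed simp
  \<comment> \<open>\<open>\<alpha> > 0\<close> makes the power continuous even at diameter 0, and
    \<open>t < top\<close> does the same for multiplication by \<open>t\<close>.\<close>
  have "((\<lambda>s. t * zeta c \<alpha> (ball y s)) \<longlongrightarrow> t * zeta c \<alpha> (ball y r)) (at_right r)"
    unfolding zeta_def
    by (intro ennreal_tendsto_cmult tendsto_ennrealI tendsto_mult_left tendsto_powr2 lim)
      (use assms in \<open>auto simp: diameter_ge_0\<close>)
  moreover have "t * zeta c \<alpha> (ball y r) < m"
    using m mult_left_mono[OF zeta_mono[OF ball_subset_cball bounded_cball \<open>c > 0\<close> \<open>\<alpha> > 0\<close>], of t y r]
    by simp
  ultimately have "\<forall>\<^sub>F s in at_right r. t * zeta c \<alpha> (ball y s) < m"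
    by (rule order_tendstoD)
  moreover have "diameter (ball y r) < \<epsilon>"
    using diam diameter_subset[OF ball_subset_cball bounded_cball, of y r] by simp
  with lim have "\<forall>\<^sub>F s in at_right r. diameter (ball y s) < \<epsilon>"
    by (rule order_tendstoD)
  ultimately have "\<forall>\<^sub>F s in at_right r. r < s \<and> t * zeta c \<alpha> (ball y s) < m \<and> diameter (ball y s) < \<epsilon>"
    using eventually_at_right_less by eventually_elim simp
  then obtain s where s: "r < s" "t * zeta c \<alpha> (ball y s) < m" "diameter (ball y s) < \<epsilon>"
    by (metis (no_types, lifting) eventually_happens trivial_limit_at_right_real)
  have sub: "cball y ((r + s) / 2) \<subseteq> ball y s"
    using s by auto
  show thesis
  proof (rule that)
    show "r < (r + s) / 2"
      using s by simp
    show "diameter (cball y ((r + s) / 2)) < \<epsilon>"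
      using s diameter_subset[OF sub bounded_ball] by simp
    show "t * zeta c \<alpha> (cball y ((r + s) / 2)) < m"
      using s mult_left_mono[OF zeta_mono[OF sub bounded_ball \<open>c > 0\<close> \<open>\<alpha> > 0\<close>], of t] by simp
  qed
qed

lemma open_upper_quotient_gt:
  fixes \<mu> :: "'a::metric_space set \<Rightarrow> ennreal"
  assumes "c > 0" "\<alpha> > 0" "t < top" and mono: "\<And>S T. S \<subseteq> T \<Longrightarrow> \<mu> S \<le> \<mu> T"
  shows "open {x \<in> interior (uniformly_regular e). t < upper_quotient c \<alpha> \<mu> e x}"
proof (subst open_contains_ball, clarify)
  fix x :: 'a
  assume x: "x \<in> interior (uniformly_regular e)" and gt: "t < upper_quotient c \<alpha> \<mu> e x"
  obtain d where d: "d > 0" "ball x d \<subseteq> interior (uniformly_regular e)"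
    using x open_contains_ball[of "interior (uniformly_regular e)"] by auto
  obtain y r0 where "r0 > 0" "x \<in> cball y r0" "diameter (cball y r0) < e"
      "t * zeta c \<alpha> (cball y r0) < \<mu> (cball y r0)"
    using gt unfolding upper_quotient_gt_iff[OF \<open>t < top\<close>] by blast
  moreover from this obtain r where "0 < r" "r < e" "cball y r = cball y r0"
    using cball_shrink_radius by metis
  ultimately have r: "0 < r" "r < e" "x \<in> cball y r" "diameter (cball y r) < e"
      "t * zeta c \<alpha> (cball y r) < \<mu> (cball y r)"
    by auto
  \<comment> \<open>The shrunken radius pays off here: \<open>dist x y \<le> r < e\<close> puts the
    centre within reach of the regularity at \<open>x\<close>.\<close>
  have "y \<in> ball x e"
    using r by (simp add: dist_commute)
  then have "continuous_on {0<..<e} (\<lambda>r. diameter (ball y r))"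
    using x interior_subset unfolding uniformly_regular_def by blast
  then obtain s where s: "r < s" "diameter (cball y s) < e"
      "t * zeta c \<alpha> (cball y s) < \<mu> (cball y r)"
    using cball_enlarge[OF _ r(1,2) assms(1-3) r(4,5)] by blast
  \<comment> \<open>Moving from \<open>x\<close> by less than \<open>s - r\<close> stays inside
    \<open>cball y s\<close>, so this one ball is a witness for all nearby \<open>z\<close>.\<close>
  have "t < upper_quotient c \<alpha> \<mu> e z" if "z \<in> ball x (s - r)" for z
    unfolding upper_quotient_gt_iff[OF \<open>t < top\<close>]
  proof (intro exI conjI)
    show "0 < s" using r s by simp
    show "z \<in> cball y s"
      using that r dist_triangle[of y z x] by simp
    show "diameter (cball y s) < e" by fact
    have "\<mu> (cball y r) \<le> \<mu> (cball y s)"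
      using s by (intro mono) auto
    with s show "t * zeta c \<alpha> (cball y s) < \<mu> (cball y s)" by simp
  qed
  then show "\<exists>d>0. ball x d \<subseteq> {x \<in> interior (uniformly_regular e). t < upper_quotient c \<alpha> \<mu> e x}"
    using d s by (intro exI[of _ "min d (s - r)"]) auto
qed

text \<open>The default \<open>top\<close> is neutral in the infimum taken later, and for finite
  \<open>t\<close> it adds only a closed set to the open superlevel set.\<close>

lemma borel_measurable_upper_quotient:
  fixes \<mu> :: "'a::metric_space set \<Rightarrow> ennreal"
  assumes "c > 0" "\<alpha> > 0" "\<And>S T. S \<subseteq> T \<Longrightarrow> \<mu> S \<le> \<mu> T"
  shows "(\<lambda>x. if x \<in> interior (uniformly_regular e) then upper_quotient c \<alpha> \<mu> e x else top)
    \<in> borel_measurable borel" (is "?g \<in> _")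
proof (rule borel_measurableI_greater)
  fix t :: ennreal
  show "{x \<in> space borel. t < ?g x} \<in> sets borel"
  proof (cases "t < top")
    case True
    then have "{x \<in> space borel. t < ?g x} = - interior (uniformly_regular e) \<union>
        {x \<in> interior (uniformly_regular e). t < upper_quotient c \<alpha> \<mu> e x}"
      by auto
    also have "\<dots> \<in> sets borel"
      using open_upper_quotient_gt[of c \<alpha> t \<mu> e] assms True
      by (intro sets.Un borel_closed borel_open) auto
    finally show ?thesis .
  next
    case False
    then have "{x \<in> space borel. t < ?g x} = {}"
      by (auto dest: less_le_trans[OF _ top_greatest])
    then show ?thesis
      by simp
  qed
qed

lemma upper_quotient_mono:
  "\<epsilon> \<le> \<epsilon>' \<Longrightarrow> upper_quotient c \<alpha> \<mu> \<epsilon> x \<le> upper_quotient c \<alpha> \<mu> \<epsilon>' x"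
  unfolding upper_quotient_def by (intro SUP_subset_mono) auto

text \<open>This makes the infimum countable. By monotonicity in \<open>\<epsilon>\<close>
  arbitrarily small values suffice, and \<open>x\<close> lies outside the interior for only finitely
  many \<open>n\<close>.\<close>

lemma federer_density_eq_INF:
  fixes x :: "'a::metric_space"
  assumes "diametrically_regular TYPE('a)"
  shows "federer_density c \<alpha> \<mu> x =
    (INF n. if x \<in> interior (uniformly_regular (1 / real (Suc n)))
       then upper_quotient c \<alpha> \<mu> (1 / real (Suc n)) x else top)" (is "_ = (INF n. ?g n)")
proof (rule antisym)
  have density: "federer_density c \<alpha> \<mu> x = (INF \<epsilon>\<in>{0<..}. upper_quotient c \<alpha> \<mu> \<epsilon> x)"
    unfolding federer_density_def upper_quotient_def ..
  show "federer_density c \<alpha> \<mu> x \<le> (INF n. ?g n)"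
    unfolding density by (intro INF_greatest) (auto intro!: INF_lower)
  obtain e where e: "e > 0" "x \<in> interior (uniformly_regular e)"
    using diametrically_regular_imp_interior assms by blast
  show "(INF n. ?g n) \<le> federer_density c \<alpha> \<mu> x"
    unfolding density
  proof (rule INF_greatest)
    fix \<epsilon> :: real
    assume "\<epsilon> \<in> {0<..}"
    then obtain n where n: "1 / real (Suc n) < min \<epsilon> e"
      using e nat_approx_posE[of "min \<epsilon> e"] by auto
    then have "x \<in> interior (uniformly_regular (1 / real (Suc n)))"
      using e interior_mono[OF uniformly_regular_antimono] by (meson less_imp_le min_less_iff_conj subsetD)
    then have "?g n \<le> upper_quotient c \<alpha> \<mu> \<epsilon> x"
      using n by (simp add: upper_quotient_mono)
    then show "(INF n. ?g n) \<le> upper_quotient c \<alpha> \<mu> \<epsilon> x"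
      by (rule INF_lower2[OF UNIV_I])
  qed
qed

theorem theorem5p6:
  fixes \<mu> :: "'a::metric_space set \<Rightarrow> ennreal"
    and c \<alpha> :: real
    and A :: "'a set"
  assumes "diametrically_regular TYPE('a)"
    and "c > 0"
    and "\<alpha> > 0"
    and "outer_measure_space UNIV \<mu>"
    and "covers_finely (nondegenerate closed_balls \<mu> (zeta c \<alpha>)) A"
  shows "federer_density c \<alpha> \<mu> \<in> borel_measurable (subspace_borel A)"
proof -
  have mono: "\<mu> S \<le> \<mu> T" if "S \<subseteq> T" for S T
    using assms(4) that unfolding outer_measure_space_UNIV_iff by blast
  have "(\<lambda>x. INF n. if x \<in> interior (uniformly_regular (1 / real (Suc n)))
      then upper_quotient c \<alpha> \<mu> (1 / real (Suc n)) x else top) \<in> borel_measurable borel"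
    by (intro borel_measurable_INF borel_measurable_upper_quotient assms(2,3) mono) auto
  then have "federer_density c \<alpha> \<mu> \<in> borel_measurable borel"
    unfolding federer_density_eq_INF[OF assms(1), abs_def] .
  \<comment> \<open>The traces on \<open>A\<close> of the Borel sets of the whole space are exactly
    the Borel sets of the subspace.\<close>
  then have "federer_density c \<alpha> \<mu> \<in> borel_measurable (restrict_space borel A)"
    by (rule measurable_restrict_space1)
  then show ?thesis
    using measurable_cong_sets[OF sets_subspace_borel refl] by blast
qed

end
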